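(* Let $f(x)=\frac{\Gamma(x)^2}{2\Gamma(2x)}$ for $x>0$. Then $$\sum_{k=1}^{\infty}3^{k-1}f(k)=\frac{2\pi}{3\sqrt3},$$ $$\sum_{k=1}^{\infty}3^{k-1}(D+\log3)f(k)=-L_{-3}(2),$$ $$\sum_{k=1}^{\infty}3^{k-1}f'(k)=-L_{-3}(2)-\frac{2\pi}{3\sqrt3}\log3.$$
   Context: $D$ denotes differentiation with respect to the argument of $f$, so $(D+\log3)f(k)=f'(k)+(\log3)f(k)$. $\chi_{-3}$ is the primitive Dirichlet character modulo $3$: $\chi_{-3}(n)=0,1,-1$ according as $n\equiv0,1,2\pmod 3$, and $L_{-3}(s)=\sum_{n=1}^\infty\chi_{-3}(n)n^{-s}$ for $\Re s>0$. *)

theory Defs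
  imports "HOL-Analysis.Analysis"
begin

definition f_gam :: "real \<Rightarrow> real" where
  "f_gam x = Gamma x ^ 2 / (2 * Gamma (2 * x))"

definition chi_m3 :: "int \<Rightarrow> int" where
  "chi_m3 n = (if n mod 3 = 1 then 1 else if n mod 3 = 2 then -1 else 0)"

(* Meaningful for Re s > 0; the sum is the limit of the partial sums, so it also covers the
   conditionally convergent range Re s \<le> 1. *)
definition L_m3 :: "complex \<Rightarrow> complex" where
  "L_m3 s = (\<Sum>n. of_int (chi_m3 (int (Suc n))) * of_nat (Suc n) powr (- s))"

end

theory Submission
  imports Defs "HOL-Real_Asymp.Real_Asymp"
begin

text \<open>The functional equation \<open>2 (2 x + 1) f (x + 1) = x f x\<close> and its derivative in \<open>x\<close> turn into
  first-order linear differential equations for the power series \<open>P\<close> and \<open>Q\<close> with coefficients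
  \<open>f (n + 1)\<close> and \<open>f' (n + 1)\<close>. Under \<open>y = 4 sin\<^sup>2 \<phi>\<close> the integrating factor is \<open>4 sin \<phi> cos \<phi>\<close>: the first
  equation gives \<open>4 sin \<phi> cos \<phi> P = 2 \<phi>\<close>, and the second shows that \<open>4 sin \<phi> cos \<phi> Q\<close> has derivative
  \<open>- 4 \<phi> cot \<phi>\<close>. Integration by parts reduces the latter to the primitive of \<open>ln (2 sin \<phi>)\<close>, which is
  the imaginary part of the dilogarithm at \<open>exp (2 \<i> \<phi>)\<close>. The sums in question are the values at
  \<open>y = 3\<close>, that is \<open>\<phi> = \<pi> / 3\<close>, where \<open>sin (2 \<pi> n / 3)\<close> is proportional to the character mod \<open>3\<close>.\<close>

section \<open>The recurrence for the function and its derivative\<close>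

lemma f_gam_plus1:
  assumes "x > 0"
  shows "2 * (2 * x + 1) * f_gam (x + 1) = x * f_gam x"
proof -
  have 1: "Gamma (x + 1) = x * Gamma x"
    using assms by (intro Gamma_plus1) auto
  have "Gamma (2 * x + 1 + 1) = (2 * x + 1) * Gamma (2 * x + 1)"
    using assms by (intro Gamma_plus1) auto
  also have "Gamma (2 * x + 1) = 2 * x * Gamma (2 * x)"
    using assms by (intro Gamma_plus1) auto
  finally have 2: "Gamma (2 * (x + 1)) = (2 * x + 1) * (2 * x * Gamma (2 * x))"
    by (simp add: algebra_simps)
  have "Gamma (2 * x) > 0"
    using assms by (intro Gamma_real_pos) auto
  moreover define k where "k = 2 * x + 1"
  ultimately show ?thesis
    unfolding f_gam_def 1 2 k_def[symmetric] using assms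
    by (simp add: divide_simps power2_eq_square) (auto simp: k_def)
qed

lemma f_gam_pos: "x > 0 \<Longrightarrow> f_gam x > 0"
  unfolding f_gam_def by (intro divide_pos_pos mult_pos_pos zero_less_power Gamma_real_pos) auto

lemma f_gam_1: "f_gam 1 = 1 / 2"
  using Gamma_fact[of 1, where ?'a = real] by (simp add: f_gam_def)

text \<open>Logarithmic differentiation: \<open>Gamma x ^ 2 / Gamma (2 * x)\<close> has logarithmic
  derivative \<open>2 * Digamma x - 2 * Digamma (2 * x)\<close>.\<close>

lemma deriv_f_gam:
  assumes "x > 0"
  shows "deriv f_gam x = 2 * f_gam x * (Digamma x - Digamma (2 * x))"
proof -
  have "Gamma (2 * x) > 0"
    using assms by (intro Gamma_real_pos) auto
  then have nz: "Gamma (2 * x) \<noteq> 0" by simp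
  have "((\<lambda>x. Gamma x ^ 2 / (2 * Gamma (2 * x))) has_field_derivative
      (2 * (Gamma x * Digamma x) * Gamma x * (2 * Gamma (2 * x)) -
        Gamma x ^ 2 * (2 * (Gamma (2 * x) * Digamma (2 * x) * 2))) / (2 * Gamma (2 * x)) ^ 2) (at x)"
    using assms nz
    by (auto intro!: derivative_eq_intros simp: power2_eq_square)
  also have "(2 * (Gamma x * Digamma x) * Gamma x * (2 * Gamma (2 * x)) -
        Gamma x ^ 2 * (2 * (Gamma (2 * x) * Digamma (2 * x) * 2))) / (2 * Gamma (2 * x)) ^ 2 =
      2 * f_gam x * (Digamma x - Digamma (2 * x))"
    using nz unfolding f_gam_def by (simp add: divide_simps) (simp add: algebra_simps power2_eq_square)
  finally have "((\<lambda>x. Gamma x ^ 2 / (2 * Gamma (2 * x))) has_field_derivative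
      2 * f_gam x * (Digamma x - Digamma (2 * x))) (at x)" .
  then show ?thesis
    unfolding f_gam_def[abs_def] by (rule DERIV_imp_deriv)
qed

lemma deriv_f_gam_1: "deriv f_gam 1 = - 1"
  using Digamma_plus1[of "1::real"] by (simp add: deriv_f_gam f_gam_1)

text \<open>This is \<open>f_gam_plus1\<close> differentiated in \<open>x\<close>, derived here from
  the recurrence of \<open>Digamma\<close>.\<close>

lemma deriv_f_gam_plus1:
  assumes "x > 0"
  shows "2 * (2 * x + 1) * deriv f_gam (x + 1) = x * deriv f_gam x + f_gam x - 4 * f_gam (x + 1)"
proof -
  have 1: "Digamma (x + 1) = Digamma x + 1 / x"
    using assms by (intro Digamma_plus1) auto
  have "Digamma (2 * x + 1 + 1) = Digamma (2 * x + 1) + 1 / (2 * x + 1)"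
    using assms by (intro Digamma_plus1) auto
  also have "Digamma (2 * x + 1) = Digamma (2 * x) + 1 / (2 * x)"
    using assms by (intro Digamma_plus1) auto
  finally have 2: "Digamma (2 * (x + 1)) = Digamma (2 * x) + 1 / (2 * x) + 1 / (2 * x + 1)"
    by (simp add: algebra_simps)
  have "2 * (2 * x + 1) * deriv f_gam (x + 1) =
      2 * (2 * (2 * x + 1) * f_gam (x + 1)) * (Digamma x - Digamma (2 * x)) +
      2 * (2 * (2 * x + 1) * f_gam (x + 1)) * (1 / (2 * x)) -
      4 * f_gam (x + 1) * ((2 * x + 1) * (1 / (2 * x + 1)))"
    unfolding deriv_f_gam[OF add_pos_pos[OF assms zero_less_one]] 1 2
    by (simp only: algebra_simps) (simp add: field_simps)
  also have "(2 * x + 1) * (1 / (2 * x + 1)) = 1"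
    using assms by simp
  finally show ?thesis
    using assms unfolding f_gam_plus1[OF assms] by (simp add: deriv_f_gam algebra_simps)
qed

lemma f_gam_Suc:
  "(4 * real n + 6) * f_gam (real (Suc (Suc n))) = real (Suc n) * f_gam (real (Suc n))"
  using f_gam_plus1[of "real (Suc n)"] by (simp add: algebra_simps)

lemma deriv_f_gam_Suc:
  "(4 * real n + 6) * deriv f_gam (real (Suc (Suc n))) =
    real (Suc n) * deriv f_gam (real (Suc n)) + f_gam (real (Suc n)) - 4 * f_gam (real (Suc (Suc n)))"
  using deriv_f_gam_plus1[of "real (Suc n)"] by (simp add: algebra_simps)

section \<open>Convergence of both power series for \<open>\<bar>y\<bar> < 4\<close>\<close>

lemma summable_f_gam:
  assumes "\<bar>y\<bar> < 4"
  shows "summable (\<lambda>n. f_gam (real (Suc n)) * y ^ n)"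
proof (rule summable_ratio_test)
  show "\<bar>y\<bar> / 4 < 1" using assms by simp
  fix n :: nat
  let ?a = "\<lambda>n. f_gam (real (Suc n))"
  have pos: "?a k > 0" for k by (intro f_gam_pos) simp
  have "(4 * real n + 6) * ?a (Suc n) \<le> (4 * real n + 6) * (?a n / 4)"
    unfolding f_gam_Suc using pos[of n] by (simp add: algebra_simps)
  then have "?a (Suc n) \<le> ?a n / 4" by (subst (asm) mult_le_cancel_left_pos) auto
  then have "?a (Suc n) * \<bar>y\<bar> ^ Suc n \<le> ?a n / 4 * \<bar>y\<bar> ^ Suc n"
    by (intro mult_right_mono) auto
  then show "norm (?a (Suc n) * y ^ Suc n) \<le> \<bar>y\<bar> / 4 * norm (?a n * y ^ n)"
    using pos[of n] pos[of "Suc n"] by (simp add: abs_mult power_abs algebra_simps)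
qed

text \<open>The upper bound is sharper than needed for convergence, but it is the one that is stable
  under the recurrence.\<close>
lemma deriv_f_gam_bounds:
  "- 2 * f_gam (real (Suc n)) \<le> deriv f_gam (real (Suc n)) \<and>
   real (Suc n) * deriv f_gam (real (Suc n)) \<le> - f_gam (real (Suc n))"
proof (induction n)
  case 0
  then show ?case by (simp add: f_gam_1 deriv_f_gam_1)
next
  case (Suc n)
  define m where "m = real n"
  define a where "a = f_gam (real (Suc n))"
  define b where "b = f_gam (real (Suc (Suc n)))"
  define d where "d = deriv f_gam (real (Suc n))"
  define e where "e = deriv f_gam (real (Suc (Suc n)))"
  have m: "m \<ge> 0" "real (Suc n) = m + 1" "real (Suc (Suc n)) = m + 2" by (auto simp: m_def)
  have ab: "(4 * m + 6) * b = (m + 1) * a"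
    using f_gam_Suc[of n] m by (simp add: m_def a_def b_def)
  have de: "(4 * m + 6) * e = (m + 1) * d + a - 4 * b"
    using deriv_f_gam_Suc[of n] by (simp add: m_def a_def b_def d_def e_def)
  have IH: "- 2 * a \<le> d" "(m + 1) * d \<le> - a"
    using Suc.IH unfolding a_def d_def m(2)[symmetric] by blast+
  have pos: "a > 0" "b > 0" by (auto simp: a_def b_def intro!: f_gam_pos)
  \<comment> \<open>Lower bound: by \<open>de\<close>, \<open>(4 * m + 6) * e\<close> is at least
    \<open>- 2 * (m + 1) * a\<close>, which is \<open>- 2 * (4 * m + 6) * b\<close> by
    \<open>ab\<close>.\<close>
  have "(m + 1) * (- 2 * a) \<le> (m + 1) * d" using IH m by (intro mult_left_mono) auto
  moreover have "a - 4 * b \<ge> 0"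
  proof -
    have "(4 * m + 6) * (4 * b) \<le> (4 * m + 6) * a"
      using ab pos m by (simp add: algebra_simps)
    then show ?thesis using m by (subst (asm) mult_le_cancel_left_pos) auto
  qed
  ultimately have "(4 * m + 6) * (- 2 * b) \<le> (4 * m + 6) * e"
    using ab de by (simp add: algebra_simps)
  then have l: "- 2 * b \<le> e" using m by (subst (asm) mult_le_cancel_left_pos) auto
  \<comment> \<open>The upper hypothesis absorbs exactly the term \<open>a\<close> of the
    recurrence; \<open>4 * (m + 2) \<ge> 4 * m + 6\<close> then restores the factor
    \<open>m + 2\<close>.\<close>
  have "(4 * m + 6) * e \<le> - 4 * b" using de IH by simp
  then have "(m + 2) * ((4 * m + 6) * e) \<le> (m + 2) * (- 4 * b)"
    using m by (intro mult_left_mono) auto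
  also have "\<dots> \<le> (4 * m + 6) * (- b)" using m pos by (simp add: algebra_simps)
  finally have "(4 * m + 6) * ((m + 2) * e) \<le> (4 * m + 6) * (- b)" by (simp add: algebra_simps)
  then have "(m + 2) * e \<le> - b" using m by (subst (asm) mult_le_cancel_left_pos) auto
  with l show ?case unfolding b_def e_def m(3)[symmetric] by blast
qed

lemma summable_deriv_f_gam:
  assumes "\<bar>y\<bar> < 4"
  shows "summable (\<lambda>n. deriv f_gam (real (Suc n)) * y ^ n)"
proof (rule summable_comparison_test'[of _ 0])
  show "summable (\<lambda>n. 2 * (f_gam (real (Suc n)) * \<bar>y\<bar> ^ n))"
    using assms by (intro summable_mult summable_f_gam) auto
  fix n :: nat
  let ?a = "f_gam (real (Suc n))" and ?d = "deriv f_gam (real (Suc n))"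
  have "?a > 0" by (intro f_gam_pos) simp
  with deriv_f_gam_bounds[of n] have "real (Suc n) * ?d \<le> 0" by linarith
  then have "?d \<le> 0" by (simp add: mult_le_0_iff)
  then have "\<bar>?d\<bar> \<le> 2 * ?a" using deriv_f_gam_bounds[of n] by simp
  then have "\<bar>?d\<bar> * \<bar>y\<bar> ^ n \<le> 2 * ?a * \<bar>y\<bar> ^ n" by (intro mult_right_mono) auto
  then show "norm (?d * y ^ n) \<le> 2 * (?a * \<bar>y\<bar> ^ n)"
    by (simp add: abs_mult power_abs)
qed

section \<open>The generating functions\<close>

definition gen :: "(nat \<Rightarrow> real) \<Rightarrow> real \<Rightarrow> real" where
  "gen c y = (\<Sum>n. c n * y ^ n)"

text \<open>The coefficient \<open>(4 * n + 2) * c n - n * c (n - 1)\<close> is the combination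
  controlled by the recurrences. At \<open>n = 0\<close> truncated subtraction gives
  \<open>c (0 - 1) = c 0\<close>, but with factor 0.\<close>

lemma gen_derivative:
  assumes summable: "\<And>y. \<bar>y\<bar> < 4 \<Longrightarrow> summable (\<lambda>n. c n * y ^ n)" and y: "\<bar>y\<bar> < 4"
  shows "(gen c has_field_derivative (\<Sum>n. diffs c n * y ^ n)) (at y)"
    and "(\<lambda>n. ((4 * real n + 2) * c n - real n * c (n - 1)) * y ^ n) sums
           ((4 - y) * y * (\<Sum>n. diffs c n * y ^ n) + (2 - y) * gen c y)"
proof -
  show "(gen c has_field_derivative (\<Sum>n. diffs c n * y ^ n)) (at y)"
    using termdiffs_strong'[of 4 c y] summable y by (simp add: gen_def[abs_def])
  have c: "(\<lambda>n. c n * y ^ n) sums gen c y"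
    unfolding gen_def using summable[OF y] by (rule summable_sums)
  have "(\<lambda>n. diffs c n * y ^ n) sums (\<Sum>n. diffs c n * y ^ n)"
    using summable y by (intro summable_sums termdiff_converges[of y 4]) auto
  from sums_mult[OF this, of y]
  have "(\<lambda>n. real (Suc n) * c (Suc n) * y ^ Suc n) sums (y * (\<Sum>n. diffs c n * y ^ n))"
    by (simp add: diffs_def algebra_simps)
  then have d: "(\<lambda>n. real n * c n * y ^ n) sums (y * (\<Sum>n. diffs c n * y ^ n))"
    using sums_Suc_iff[of "\<lambda>n. real n * c n * y ^ n"] by simp
  have "(\<lambda>n. y * (real n * c n * y ^ n + c n * y ^ n)) sums
      (y * (y * (\<Sum>n. diffs c n * y ^ n) + gen c y))"
    by (intro sums_mult sums_add c d)
  then have "(\<lambda>n. real (Suc n) * c (Suc n - 1) * y ^ Suc n) sums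
      (y * (y * (\<Sum>n. diffs c n * y ^ n) + gen c y))"
    by (simp add: algebra_simps)
  then have e: "(\<lambda>n. real n * c (n - 1) * y ^ n) sums
      (y * (y * (\<Sum>n. diffs c n * y ^ n) + gen c y))"
    using sums_Suc_iff[of "\<lambda>n. real n * c (n - 1) * y ^ n"] by simp
  have "(\<lambda>n. 4 * (real n * c n * y ^ n) + 2 * (c n * y ^ n) - real n * c (n - 1) * y ^ n) sums
      (4 * (y * (\<Sum>n. diffs c n * y ^ n)) + 2 * gen c y -
        y * (y * (\<Sum>n. diffs c n * y ^ n) + gen c y))"
    by (intro sums_add sums_diff sums_mult c d e)
  then show "(\<lambda>n. ((4 * real n + 2) * c n - real n * c (n - 1)) * y ^ n) sums
           ((4 - y) * y * (\<Sum>n. diffs c n * y ^ n) + (2 - y) * gen c y)"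
    by (simp add: algebra_simps)
qed

text \<open>With \<open>y = 4 sin\<^sup>2 \<phi>\<close> the differential operator of \<open>gen_derivative\<close> becomes, after
  multiplication by \<open>4 sin \<phi> cos \<phi>\<close>, half of an exact derivative.\<close>

definition trig_gen :: "(nat \<Rightarrow> real) \<Rightarrow> real \<Rightarrow> real" where
  "trig_gen c \<phi> = 4 * sin \<phi> * cos \<phi> * gen c (4 * sin \<phi> ^ 2)"

lemma four_sin_sq_less: "\<bar>\<phi>\<bar> < pi / 2 \<Longrightarrow> \<bar>4 * sin \<phi> ^ 2\<bar> < 4" for \<phi> :: real
proof -
  assume "\<bar>\<phi>\<bar> < pi / 2"
  then have "cos \<phi> > 0" by (intro cos_gt_zero_pi) linarith+
  then have "cos \<phi> ^ 2 > 0" by (rule zero_less_power)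
  then have "sin \<phi> ^ 2 < 1" using sin_cos_squared_add[of \<phi>] by linarith
  then show ?thesis by simp
qed

text \<open>The product rule matches the operator because
  \<open>4 * (cos \<phi> ^ 2 - sin \<phi> ^ 2) = 2 * (2 - y)\<close> and
  \<open>16 * sin \<phi> ^ 2 * cos \<phi> ^ 2 = y * (4 - y)\<close>.\<close>

lemma trig_gen_derivative:
  assumes summable: "\<And>y. \<bar>y\<bar> < 4 \<Longrightarrow> summable (\<lambda>n. c n * y ^ n)" and \<phi>: "\<bar>\<phi>\<bar> < pi / 2"
    and sums: "(\<lambda>n. ((4 * real n + 2) * c n - real n * c (n - 1)) * (4 * sin \<phi> ^ 2) ^ n) sums S"
  shows "(trig_gen c has_field_derivative 2 * S) (at \<phi>)"
proof -
  define y where "y = 4 * sin \<phi> ^ 2"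
  have y: "\<bar>y\<bar> < 4" unfolding y_def using \<phi> by (rule four_sin_sq_less)
  define D where "D = (\<Sum>n. diffs c n * y ^ n)"
  have der: "(gen c has_field_derivative D) (at (4 * sin \<phi> ^ 2))"
    using gen_derivative(1)[OF summable y] by (simp add: D_def y_def)
  have S: "S = (4 - y) * y * D + (2 - y) * gen c y"
    using sums gen_derivative(2)[OF summable y] unfolding y_def[symmetric] D_def
    by (rule sums_unique2)
  have "((\<lambda>\<phi>. gen c (4 * sin \<phi> ^ 2)) has_field_derivative D * (8 * sin \<phi> * cos \<phi>)) (at \<phi>)"
    by (rule DERIV_chain2[where f = "gen c" and g = "\<lambda>\<phi>. 4 * sin \<phi> ^ 2", OF der])
       (auto intro!: derivative_eq_intros)
  then have "(trig_gen c has_field_derivative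
      4 * (cos \<phi> ^ 2 - sin \<phi> ^ 2) * gen c y + 4 * sin \<phi> * cos \<phi> * (D * (8 * sin \<phi> * cos \<phi>)))
      (at \<phi>)"
    unfolding trig_gen_def[abs_def] y_def
    by (auto intro!: derivative_eq_intros simp: algebra_simps power2_eq_square)
  also have "4 * (cos \<phi> ^ 2 - sin \<phi> ^ 2) * gen c y + 4 * sin \<phi> * cos \<phi> * (D * (8 * sin \<phi> * cos \<phi>))
      = 2 * S"
  proof -
    have "4 * (cos \<phi> ^ 2 - sin \<phi> ^ 2) = 2 * (2 - y)"
      by (simp add: y_def cos_squared_eq)
    moreover have "4 * sin \<phi> * cos \<phi> * (D * (8 * sin \<phi> * cos \<phi>)) = 2 * ((4 * cos \<phi> ^ 2) * y * D)"
      by (simp add: y_def power2_eq_square algebra_simps)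
    moreover have "4 * cos \<phi> ^ 2 = 4 - y" by (simp add: y_def cos_squared_eq)
    ultimately show ?thesis unfolding S by (simp only: distrib_left mult.assoc)
  qed
  finally show ?thesis .
qed

abbreviation (input) f_coeff :: "nat \<Rightarrow> real" where
  "f_coeff n \<equiv> f_gam (real (Suc n))"

abbreviation (input) f'_coeff :: "nat \<Rightarrow> real" where
  "f'_coeff n \<equiv> deriv f_gam (real (Suc n))"

text \<open>The recurrence kills every coefficient except the constant one,
  \<open>2 * f_gam 1 = 1\<close>, so the derivative is 2; the value at 0 is 0. This is the classical
  series of \<open>arcsin x / sqrt (1 - x ^ 2)\<close>.\<close>

lemma trig_gen_f:
  assumes "\<bar>\<phi>\<bar> < pi / 2"
  shows "trig_gen f_coeff \<phi> = 2 * \<phi>"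
proof -
  have der: "(trig_gen f_coeff has_field_derivative 2 * 1) (at x)" if "\<bar>x\<bar> < pi / 2" for x
  proof (rule trig_gen_derivative[OF summable_f_gam that])
    have "((4 * real n + 2) * f_coeff n - real n * f_coeff (n - 1)) * (4 * sin x ^ 2) ^ n =
        (if n = 0 then 1 else 0)" for n
      using f_gam_Suc[of "n - 1"] by (cases n) (auto simp: f_gam_1 algebra_simps)
    then show "(\<lambda>n. ((4 * real n + 2) * f_coeff n - real n * f_coeff (n - 1)) * (4 * sin x ^ 2) ^ n)
        sums 1"
      using sums_single[of 0 "\<lambda>_. 1::real"] by simp
  qed
  have "trig_gen f_coeff \<phi> - 2 * \<phi> = trig_gen f_coeff 0 - 2 * 0"
    using assms
    by (intro DERIV_isconst3[of "- (pi / 2)" "pi / 2"])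
       (auto intro!: derivative_eq_intros der[simplified])
  then show ?thesis by (simp add: trig_gen_def)
qed

text \<open>The inhomogeneous terms of the recurrence sum to \<open>(y - 4) * gen f_coeff y\<close>,
  where \<open>y - 4 = - 4 * cos \<phi> ^ 2\<close>, and \<open>trig_gen_f\<close> evaluates the
  remaining series.\<close>

lemma trig_gen_f'_derivative:
  assumes "\<bar>\<phi>\<bar> < pi / 2" "\<phi> \<noteq> 0"
  shows "(trig_gen f'_coeff has_field_derivative - 4 * \<phi> * cos \<phi> / sin \<phi>) (at \<phi>)"
proof -
  define y where "y = 4 * sin \<phi> ^ 2"
  have y: "\<bar>y\<bar> < 4" unfolding y_def by (rule four_sin_sq_less) fact
  have "(trig_gen f'_coeff has_field_derivative 2 * (y * gen f_coeff y - 4 * gen f_coeff y)) (at \<phi>)"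
  proof (rule trig_gen_derivative[OF summable_deriv_f_gam assms(1)])
    have f: "(\<lambda>n. f_coeff n * y ^ n) sums gen f_coeff y"
      unfolding gen_def by (rule summable_sums[OF summable_f_gam[OF y]])
    have "(\<lambda>n. f_coeff (Suc n - 1) * y ^ Suc n) sums (y * gen f_coeff y)"
      using sums_mult[OF f, of y] by (simp add: algebra_simps)
    \<comment> \<open>The case distinction is essential: \<open>f_coeff (0 - 1)\<close> would be
      \<open>f_coeff 0\<close>, not 0.\<close>
    then have "(\<lambda>n. if n = 0 then 0 else f_coeff (n - 1) * y ^ n) sums (y * gen f_coeff y)"
      using sums_Suc_iff[of "\<lambda>n. if n = 0 then 0 else f_coeff (n - 1) * y ^ n"] by simp
    then have "(\<lambda>n. (if n = 0 then 0 else f_coeff (n - 1) * y ^ n) - 4 * (f_coeff n * y ^ n)) sums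
        (y * gen f_coeff y - 4 * gen f_coeff y)"
      by (intro sums_diff sums_mult f)
    moreover have "(if n = 0 then 0 else f_coeff (n - 1) * y ^ n) - 4 * (f_coeff n * y ^ n) =
        ((4 * real n + 2) * f'_coeff n - real n * f'_coeff (n - 1)) * y ^ n" for n
    proof (cases n)
      \<comment> \<open>The constant term is the initial condition
        \<open>2 * deriv f_gam 1 = - 4 * f_gam 1\<close>.\<close>
      case 0
      then show ?thesis by (simp add: f_gam_1 deriv_f_gam_1)
    next
      case (Suc m)
      have "(4 * real n + 2) * f'_coeff n - real n * f'_coeff (n - 1) = f_coeff m - 4 * f_coeff n"
        using deriv_f_gam_Suc[of m] by (simp add: Suc algebra_simps)
      then have "((4 * real n + 2) * f'_coeff n - real n * f'_coeff (n - 1)) * y ^ n =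
          (f_coeff m - 4 * f_coeff n) * y ^ n" by simp
      then show ?thesis by (simp only: Suc left_diff_distrib) simp
    qed
    ultimately show "(\<lambda>n. ((4 * real n + 2) * f'_coeff n - real n * f'_coeff (n - 1)) *
        (4 * sin \<phi> ^ 2) ^ n) sums (y * gen f_coeff y - 4 * gen f_coeff y)"
      by (simp add: y_def)
  qed
  moreover have "2 * (y * gen f_coeff y - 4 * gen f_coeff y) = - 4 * \<phi> * cos \<phi> / sin \<phi>"
  proof -
    have "sin \<phi> \<noteq> 0"
      using assms sin_gt_zero[of \<phi>] sin_gt_zero[of "- \<phi>"] by
      (cases \<phi> "0::real" rule: linorder_cases) auto
    moreover have "2 * (y * gen f_coeff y - 4 * gen f_coeff y) * sin \<phi> = - 4 * \<phi> * cos \<phi>"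
    proof -
      have "2 * (y * gen f_coeff y - 4 * gen f_coeff y) = - 2 * (4 * cos \<phi> ^ 2) * gen f_coeff y"
        by (simp add: y_def cos_squared_eq algebra_simps)
      then have "2 * (y * gen f_coeff y - 4 * gen f_coeff y) * sin \<phi> =
          - 2 * cos \<phi> * (4 * sin \<phi> * cos \<phi> * gen f_coeff y)"
        by (simp only: power2_eq_square mult_ac)
      also have "4 * sin \<phi> * cos \<phi> * gen f_coeff y = 2 * \<phi>"
        using trig_gen_f[OF assms(1)] by (simp only: trig_gen_def y_def)
      finally show ?thesis by simp
    qed
    ultimately show ?thesis by (simp only: nonzero_eq_divide_eq not_False_eq_True)
  qed
  ultimately show ?thesis by simp
qed

section \<open>The dilogarithm on the unit circle\<close>

text \<open>Starting at \<open>n = 0\<close> is harmless, since \<open>1 / 0 = 0\<close>.\<close>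

definition dilog :: "complex \<Rightarrow> complex" where
  "dilog z = (\<Sum>n. 1 / of_nat n ^ 2 * z ^ n)"

lemma summable_inverse_squares: "summable (\<lambda>n. 1 / real n ^ 2)"
  using inverse_power_summable[of 2, where ?'a = real] by (simp add: inverse_eq_divide)

lemma summable_dilog: "norm z \<le> 1 \<Longrightarrow> summable (\<lambda>n. 1 / of_nat n ^ 2 * z ^ n :: complex)"
  by (rule summable_comparison_test'[of "\<lambda>n. 1 / real n ^ 2" 0])
     (auto simp: norm_mult norm_divide norm_power summable_inverse_squares
         intro!: divide_right_mono power_le_one)

text \<open>Uniform convergence up to the boundary is what later permits the limit
  \<open>r \<longlongrightarrow> 1\<close>.\<close>

lemma continuous_on_dilog: "continuous_on (cball 0 1) dilog"
proof (rule uniform_limit_theorem)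
  show "uniform_limit (cball 0 1) (\<lambda>N z. \<Sum>n<N. 1 / of_nat n ^ 2 * z ^ n) dilog sequentially"
    unfolding dilog_def[abs_def]
    by (rule Weierstrass_m_test[of _ _ "\<lambda>n. 1 / real n ^ 2"])
       (auto simp: norm_mult norm_divide norm_power summable_inverse_squares
         intro!: divide_right_mono power_le_one)
qed (auto intro!: always_eventually continuous_on_sum continuous_on_mult_left continuous_on_power
  continuous_on_id simp del: times_divide_eq_left)

lemma dilog_derivative:
  assumes "norm z < 1" "z \<noteq> 0"
  shows "(dilog has_field_derivative - Ln (1 - z) / z) (at z)"
proof -
  let ?w = "\<lambda>n. 1 / of_nat n ^ 2 :: complex"
  have 1: "(dilog has_field_derivative (\<Sum>n. diffs ?w n * z ^ n)) (at z)"
    using termdiffs_strong'[of 1 ?w z] summable_dilog assms by (simp add: dilog_def[abs_def])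
  have "(\<lambda>n. - (z ^ n / of_nat n)) sums Ln (1 - z)"
    using Ln_series'[of "- z"] assms by simp
  then have "(\<lambda>n. - (z ^ Suc n / of_nat (Suc n))) sums Ln (1 - z)"
    using sums_Suc_iff[of "\<lambda>n. - (z ^ n / of_nat n)"] by simp
  from sums_mult[OF this, of "- 1 / z"]
  have "(\<lambda>n. diffs ?w n * z ^ n) sums (- Ln (1 - z) / z)"
    using assms by (simp add: diffs_def power2_eq_square field_simps del: of_nat_Suc)
  with 1 show ?thesis by (simp add: sums_iff)
qed

text \<open>By the chain rule the complex derivative is \<open>- 2 * \<i> * Ln (1 - z)\<close>, and
  the real part of \<open>Ln\<close> is the logarithm of the norm.\<close>

lemma Im_dilog_derivative:
  assumes "0 < r" "r < 1"
  shows "((\<lambda>\<phi>. Im (dilog (of_real r * cis (2 * \<phi>)))) has_field_derivative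
           - 2 * ln (norm (1 - of_real r * cis (2 * \<phi>)))) (at \<phi>)"
proof -
  define z where "z = of_real r * cis (2 * \<phi>)"
  have z: "norm z < 1" "z \<noteq> 0" using assms by (auto simp: z_def norm_mult)
  have "((\<lambda>\<phi>. of_real r * cis (2 * \<phi>)) has_vector_derivative 2 * \<i> * z) (at \<phi>)"
    unfolding z_def cis_conv_exp
    by (auto intro!: derivative_eq_intros has_vector_derivative_real_field simp: field_simps)
  moreover have "(dilog has_field_derivative - Ln (1 - z) / z) (at (of_real r * cis (2 * \<phi>)))"
    using dilog_derivative[OF z] by (simp add: z_def)
  ultimately have "(dilog \<circ> (\<lambda>\<phi>. of_real r * cis (2 * \<phi>)) has_vector_derivative
      2 * \<i> * z * (- Ln (1 - z) / z)) (at \<phi>)"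
    by (rule field_vector_diff_chain_at)
  also have "2 * \<i> * z * (- Ln (1 - z) / z) = - 2 * \<i> * Ln (1 - z)" using z by simp
  finally have "((\<lambda>\<phi>. Im (dilog (of_real r * cis (2 * \<phi>)))) has_field_derivative
      Im (- 2 * \<i> * Ln (1 - z))) (at \<phi>)"
    unfolding o_def by (rule has_field_derivative_Im)
  moreover have "1 - z \<noteq> 0" using z by auto
  ultimately show ?thesis by (simp add: z_def)
qed

lemma norm_one_minus_cis: "norm (1 - cis (2 * \<phi>)) = 2 * \<bar>sin \<phi>\<bar>"
  using dist_exp_i_1[of "2 * \<phi>"] by (simp add: cis_conv_exp norm_minus_commute)

lemma abs_ln_le_double:
  fixes x :: real
  assumes "\<bar>x - 1\<bar> \<le> 1 / 2"
  shows "\<bar>ln x\<bar> \<le> 2 * \<bar>x - 1\<bar>"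
proof -
  have "\<bar>ln (1 + (x - 1)) - (x - 1)\<bar> \<le> 2 * (x - 1)\<^sup>2"
    using assms by (rule abs_ln_one_plus_x_minus_x_bound)
  then have "\<bar>ln x - (x - 1)\<bar> \<le> 2 * (x - 1)\<^sup>2" by simp
  also have "2 * (x - 1)\<^sup>2 \<le> \<bar>x - 1\<bar>"
    using mult_right_mono[OF assms, of "\<bar>x - 1\<bar>"] by (simp add: power2_eq_square)
  finally show ?thesis
    using abs_triangle_ineq[of "ln x - (x - 1)" "x - 1"] by simp
qed

text \<open>The primitive of \<open>ln (2 sin \<phi>)\<close> is compared on the circle of radius \<open>r < 1\<close>, where the
  dilogarithm is differentiable; the derivatives agree up to \<open>O(1 - r)\<close> uniformly away from
  \<open>\<phi> = 0\<close>.\<close>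
lemma primitive_ln_two_sin:
  assumes der: "\<And>\<phi>. 0 < \<phi> \<Longrightarrow> \<phi> < pi / 2 \<Longrightarrow> (E has_field_derivative 4 * ln (2 * sin \<phi>)) (at \<phi>)"
    and \<epsilon>: "0 < \<epsilon>" "\<epsilon> \<le> x" "x < pi / 2"
  shows "E x + 2 * Im (dilog (cis (2 * x))) = E \<epsilon> + 2 * Im (dilog (cis (2 * \<epsilon>)))"
proof -
  define h where "h = (\<lambda>r \<phi>. E \<phi> + 2 * Im (dilog (of_real r * cis (2 * \<phi>))))"
  \<comment> \<open>Derivative bound \<open>4 / sin \<epsilon> * (1 - r)\<close> times the interval
    length, without the factor \<open>1 - r\<close>.\<close>
  define K where "K = 4 / sin \<epsilon> * (x - \<epsilon>)"
  have sin\<epsilon>: "sin \<epsilon> > 0" using \<epsilon> by (intro sin_gt_zero) auto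
  have bound: "\<bar>h r x - h r \<epsilon>\<bar> \<le> K * (1 - r)"
    if r: "0 < r" "r < 1" "1 - r \<le> sin \<epsilon>" for r
  proof -
    have "norm (h r x - h r \<epsilon>) \<le> 4 / sin \<epsilon> * (1 - r) * norm (x - \<epsilon>)"
    proof (rule field_differentiable_bound)
      fix \<phi> assume \<phi>: "\<phi> \<in> {\<epsilon>..x}"
      let ?l = "4 * ln (2 * sin \<phi>) - 4 * ln (norm (1 - of_real r * cis (2 * \<phi>)))"
      have "(h r has_field_derivative
          4 * ln (2 * sin \<phi>) + 2 * (- 2 * ln (norm (1 - of_real r * cis (2 * \<phi>))))) (at \<phi>)"
        unfolding h_def using \<phi> \<epsilon> r
        by (intro DERIV_add DERIV_cmult der Im_dilog_derivative) auto
      from has_field_derivative_at_within[OF this]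
      show "(h r has_field_derivative ?l) (at \<phi> within {\<epsilon>..x})" by simp
      have s: "sin \<phi> \<ge> sin \<epsilon>" using \<phi> \<epsilon> by (intro sin_monotone_2pi_le) auto
      \<comment> \<open>The ratio of the distances from 1 to the points of radius \<open>r\<close>
        and 1; the derivative of \<open>h r\<close> is \<open>- 4 * ln q\<close>. The condition
        \<open>1 - r \<le> sin \<epsilon>\<close> puts \<open>q\<close> within \<open>1 / 2\<close>
        of 1, as \<open>abs_ln_le_double\<close> requires.\<close>
      define q where "q = norm (1 - of_real r * cis (2 * \<phi>)) / (2 * sin \<phi>)"
      have "\<bar>norm (1 - of_real r * cis (2 * \<phi>)) - norm (1 - cis (2 * \<phi>))\<bar> \<le>
          norm ((1 - of_real r * cis (2 * \<phi>)) - (1 - cis (2 * \<phi>)))"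
        by (rule norm_triangle_ineq3)
      also have "(1 - of_real r * cis (2 * \<phi>)) - (1 - cis (2 * \<phi>)) = of_real (1 - r) * cis (2 * \<phi>)"
        by (simp add: algebra_simps)
      also have "norm \<dots> = 1 - r" using r by (simp add: norm_mult del: of_real_diff)
      finally have "\<bar>norm (1 - of_real r * cis (2 * \<phi>)) - 2 * sin \<phi>\<bar> \<le> 1 - r"
        using s sin\<epsilon> by (simp add: norm_one_minus_cis)
      moreover have "q - 1 = (norm (1 - of_real r * cis (2 * \<phi>)) - 2 * sin \<phi>) / (2 * sin \<phi>)"
        using s sin\<epsilon> by (simp add: q_def field_simps)
      ultimately have "\<bar>q - 1\<bar> \<le> (1 - r) / (2 * sin \<phi>)"
        using s sin\<epsilon> by (simp add: divide_right_mono)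
      also have "\<dots> \<le> (1 - r) / (2 * sin \<epsilon>)"
        using s sin\<epsilon> r by (intro divide_left_mono) auto
      finally have q: "\<bar>q - 1\<bar> \<le> (1 - r) / (2 * sin \<epsilon>)" .
      also have "\<dots> \<le> 1 / 2" using r sin\<epsilon> by (simp add: field_simps)
      finally have "\<bar>ln q\<bar> \<le> 2 * \<bar>q - 1\<bar>" by (rule abs_ln_le_double)
      also have "\<dots> \<le> 2 * ((1 - r) / (2 * sin \<epsilon>))" by (intro mult_left_mono q) simp
      finally have "4 * \<bar>ln q\<bar> \<le> 4 * (2 * ((1 - r) / (2 * sin \<epsilon>)))"
        by (rule mult_left_mono) simp
      also have "\<dots> = 4 / sin \<epsilon> * (1 - r)" using sin\<epsilon> by (simp add: field_simps)
      finally have "4 * \<bar>ln q\<bar> \<le> 4 / sin \<epsilon> * (1 - r)" .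
      moreover have "norm (of_real r * cis (2 * \<phi>)) \<noteq> 1" using r by (simp add: norm_mult)
      then have "1 - of_real r * cis (2 * \<phi>) \<noteq> 0" by auto
      then have "?l = - 4 * ln q"
        using s sin\<epsilon> by (simp add: q_def ln_div)
      ultimately show "norm ?l \<le> 4 / sin \<epsilon> * (1 - r)" by simp
    qed (use \<epsilon> in auto)
    then show ?thesis using \<epsilon> by (simp add: K_def algebra_simps)
  qed
  have lim: "((\<lambda>r. h r \<phi>) \<longlongrightarrow> h 1 \<phi>) (at_left 1)" for \<phi>
  proof -
    have "((\<lambda>r. of_real r * cis (2 * \<phi>)) \<longlongrightarrow> of_real 1 * cis (2 * \<phi>)) (at_left 1)"
      by (intro tendsto_intros)
    moreover have "eventually (\<lambda>r. of_real r * cis (2 * \<phi>) \<in> cball 0 1) (at_left (1::real))"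
      using eventually_at_left_real[OF zero_less_one]
      by (rule eventually_mono) (auto simp: norm_mult)
    ultimately have "((\<lambda>r. dilog (of_real r * cis (2 * \<phi>))) \<longlongrightarrow> dilog (of_real 1 * cis (2 * \<phi>)))
        (at_left 1)"
      by (intro continuous_on_tendsto_compose[OF continuous_on_dilog]) auto
    then show ?thesis unfolding h_def by (intro tendsto_intros)
  qed
  have "((\<lambda>r. \<bar>h r x - h r \<epsilon>\<bar>) \<longlongrightarrow> \<bar>h 1 x - h 1 \<epsilon>\<bar>) (at_left 1)"
    by (intro tendsto_intros lim)
  moreover have "((\<lambda>r. K * (1 - r)) \<longlongrightarrow> K * (1 - 1)) (at_left 1)"
    by (intro tendsto_intros)
  moreover have "eventually (\<lambda>r. \<bar>h r x - h r \<epsilon>\<bar> \<le> K * (1 - r)) (at_left 1)"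
  proof (rule eventually_mono)
    show "eventually (\<lambda>r. r \<in> {1 - sin \<epsilon><..<1}) (at_left 1)"
      using sin\<epsilon> by (intro eventually_at_left_real) simp
    show "\<bar>h r x - h r \<epsilon>\<bar> \<le> K * (1 - r)" if "r \<in> {1 - sin \<epsilon><..<1}" for r
    proof (rule bound)
      have "1 - sin \<epsilon> < r" using that by simp
      with sin_le_one[of \<epsilon>] show "0 < r" by linarith
    qed (use that in auto)
  qed
  ultimately have "\<bar>h 1 x - h 1 \<epsilon>\<bar> \<le> K * (1 - 1)"
    by (intro tendsto_le[of "at_left (1::real)"]) auto
  then show ?thesis by (simp add: h_def)
qed

text \<open>Letting \<epsilon> tend to 0 fixes the constant: \<open>E\<close> tends to 0 and
  \<open>dilog 1\<close> is real.\<close>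

lemma primitive_ln_two_sin_eq_dilog:
  assumes der: "\<And>\<phi>. 0 < \<phi> \<Longrightarrow> \<phi> < pi / 2 \<Longrightarrow> (E has_field_derivative 4 * ln (2 * sin \<phi>)) (at \<phi>)"
    and lim: "(E \<longlongrightarrow> 0) (at_right 0)" and x: "0 < x" "x < pi / 2"
  shows "E x = - 2 * Im (dilog (cis (2 * x)))"
proof -
  let ?h = "\<lambda>\<phi>. E \<phi> + 2 * Im (dilog (cis (2 * \<phi>)))"
  have "continuous_on UNIV (\<lambda>\<phi>. dilog (cis (2 * \<phi>)))"
    by (intro continuous_on_compose2[OF continuous_on_dilog] continuous_intros) auto
  then have "((\<lambda>\<phi>. dilog (cis (2 * \<phi>))) \<longlongrightarrow> dilog (cis (2 * 0))) (at_right 0)"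
    by (metis UNIV_I at_le continuous_on_def subset_UNIV tendsto_mono)
  then have "(?h \<longlongrightarrow> 0 + 2 * Im (dilog (cis (2 * 0)))) (at_right 0)"
    by (intro tendsto_intros lim)
  moreover have "Im (dilog 1) = 0"
  proof -
    have "dilog 1 = (\<Sum>n. of_real (1 / real n ^ 2))"
      by (simp add: dilog_def)
    also have "\<dots> = of_real (\<Sum>n. 1 / real n ^ 2)"
      by (rule suminf_of_real[symmetric])
         (simp add: summable_inverse_squares)
    finally show ?thesis by simp
  qed
  ultimately have "(?h \<longlongrightarrow> 0) (at_right 0)" by simp
  moreover have "eventually (\<lambda>\<epsilon>. ?h \<epsilon> = ?h x) (at_right 0)"
    using eventually_at_right_real[of 0 x] x
    by (auto elim!: eventually_mono intro!: primitive_ln_two_sin[OF der, symmetric])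
  ultimately have "((\<lambda>\<epsilon>::real. ?h x) \<longlongrightarrow> 0) (at_right 0)"
    by (rule Lim_transform_eventually)
  then show ?thesis by (simp add: tendsto_const_iff)
qed

section \<open>The L-value as a dilogarithm at a cube root of unity\<close>

lemma sin_third_multiples: "sin (2 * pi / 3 * real n) = sqrt 3 / 2 * of_int (chi_m3 (int n))"
proof -
  define k where "k = n div 3"
  have red: "sin (2 * pi / 3 * real (3 * k + j)) = sin (2 * pi / 3 * real j)" for j
  proof -
    have "2 * pi / 3 * real (3 * k + j) = 2 * pi / 3 * real j + real k * (2 * pi)"
      by (simp add: field_simps)
    then show ?thesis
      using sin.plus_of_nat[of "2 * pi / 3 * real j" k] by (simp only: of_real_eq_id id_apply)
  qed
  have chi: "chi_m3 (int (3 * k + j)) = chi_m3 (int j)" for j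
    by (simp add: chi_m3_def)
  have "sin (2 * pi / 3 * real j) = sqrt 3 / 2 * of_int (chi_m3 (int j))" if "j < 3" for j
  proof -
    have "sin (2 * pi / 3 * 2) = sin (pi / 3 + pi)" by (simp add: field_simps)
    then have "sin (2 * pi / 3 * 2) = - (sqrt 3 / 2)" by (simp only: sin_periodic_pi sin_60)
    moreover have "sin (2 * pi / 3) = sqrt 3 / 2" using sin_120' by (simp add: mult.commute)
    moreover have "j \<in> {0, 1, 2}" using that by auto
    ultimately show ?thesis by (auto simp: chi_m3_def)
  qed
  from this[of "n mod 3"] show ?thesis
    using red[of "n mod 3"] chi[of "n mod 3"] by (simp add: k_def)
qed

lemma L_m3_2: "L_m3 2 = of_real (2 / sqrt 3 * Im (dilog (cis (2 * pi / 3))))"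
proof -
  let ?t = "\<lambda>n. sin (2 * pi / 3 * real n) / real n ^ 2"
  have "(\<lambda>n. Im (1 / of_nat n ^ 2 * cis (2 * pi / 3) ^ n)) sums Im (dilog (cis (2 * pi / 3)))"
    unfolding dilog_def by (intro sums_Im summable_sums summable_dilog) simp
  moreover have "Im (1 / of_nat n ^ 2 * cis (2 * pi / 3) ^ n) = ?t n" for n
  proof -
    have c: "cis (2 * pi / 3) ^ n = cis (2 * pi / 3 * real n)"
      by (simp only: Complex.DeMoivre mult.commute)
    have "1 / of_nat n ^ 2 * cis (2 * pi / 3) ^ n =
        of_real (1 / real n ^ 2) * cis (2 * pi / 3 * real n)"
      unfolding c by simp
    then have "Im (1 / of_nat n ^ 2 * cis (2 * pi / 3) ^ n) =
        Im (of_real (1 / real n ^ 2) * cis (2 * pi / 3 * real n))" by (rule arg_cong)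
    also have "\<dots> = ?t n" by simp
    finally show ?thesis .
  qed
  ultimately have "?t sums Im (dilog (cis (2 * pi / 3)))" by (simp only:)
  \<comment> \<open>The term at 0 vanishes, so the sum may start at 1 as in
    \<open>L_m3\<close>.\<close>
  then have "(\<lambda>n. ?t (Suc n)) sums Im (dilog (cis (2 * pi / 3)))"
    using sums_Suc_iff[of ?t] by simp
  then have "(\<lambda>n. complex_of_real (2 / sqrt 3 * ?t (Suc n))) sums
      complex_of_real (2 / sqrt 3 * Im (dilog (cis (2 * pi / 3))))"
    by (intro sums_of_real sums_mult)
  moreover have "complex_of_real (2 / sqrt 3 * ?t (Suc n)) =
      of_int (chi_m3 (int (Suc n))) * of_nat (Suc n) powr (- 2)" for n
  proof -
    have "of_nat (Suc n) powr (- 2 :: complex) = 1 / of_nat (Suc n) ^ 2"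
      using powr_nat'[of "of_nat (Suc n) :: complex" 2] by (simp add: powr_minus inverse_eq_divide)
    moreover have "2 / sqrt 3 * ?t (Suc n) = of_int (chi_m3 (int (Suc n))) / real (Suc n) ^ 2"
      unfolding sin_third_multiples by simp
    ultimately show ?thesis by simp
  qed
  ultimately show ?thesis unfolding L_m3_def by (simp add: sums_iff)
qed

section \<open>Evaluation at the angle of sixty degrees\<close>

lemma trig_gen_third: "trig_gen c (pi / 3) = sqrt 3 * gen c 3"
  by (simp add: trig_gen_def sin_60 cos_60 power_divide)

lemma gen_f'_3:
  "gen f'_coeff 3 = - (2 / sqrt 3 * Im (dilog (cis (2 * pi / 3)))) - 2 * pi / (3 * sqrt 3) * ln 3"
proof -
  \<comment> \<open>Integration by parts: the added product cancels the cotangent term of the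
    derivative and leaves \<open>4 * ln (2 * sin \<phi>)\<close>.\<close>
  define E where "E = (\<lambda>\<phi>. trig_gen f'_coeff \<phi> + 4 * \<phi> * ln (2 * sin \<phi>))"
  have "E (pi / 3) = - 2 * Im (dilog (cis (2 * (pi / 3))))"
  proof (rule primitive_ln_two_sin_eq_dilog)
    show "(E has_field_derivative 4 * ln (2 * sin \<phi>)) (at \<phi>)" if "0 < \<phi>" "\<phi> < pi / 2" for \<phi>
    proof -
      have "sin \<phi> > 0" using that by (intro sin_gt_zero) auto
      then have "((\<lambda>\<phi>. 4 * \<phi> * ln (2 * sin \<phi>)) has_field_derivative
          4 * ln (2 * sin \<phi>) + 4 * \<phi> * cos \<phi> / sin \<phi>) (at \<phi>)"
        by (auto intro!: derivative_eq_intros simp: field_simps)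
      from DERIV_add[OF trig_gen_f'_derivative this] show ?thesis
        using that unfolding E_def by simp
    qed
    \<comment> \<open>\<open>trig_gen_f'_derivative\<close> excludes 0, so continuity there comes
      from the general derivative rule.\<close>
    have "isCont (trig_gen f'_coeff) 0"
      using trig_gen_derivative[OF summable_deriv_f_gam, of 0]
        gen_derivative(2)[OF summable_deriv_f_gam, of 0]
      by (auto intro!: DERIV_isCont)
    then have "(trig_gen f'_coeff \<longlongrightarrow> trig_gen f'_coeff 0) (at_right 0)"
      by (simp add: continuous_at_imp_continuous_at_within continuous_within[symmetric])
    moreover have "((\<lambda>\<phi>::real. 4 * \<phi> * ln (2 * sin \<phi>)) \<longlongrightarrow> 0) (at_right 0)"
      by real_asymp
    ultimately have "(E \<longlongrightarrow> trig_gen f'_coeff 0 + 0) (at_right 0)"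
      unfolding E_def by (rule tendsto_add)
    then show "(E \<longlongrightarrow> 0) (at_right 0)" by (simp add: trig_gen_def)
  qed auto
  \<comment> \<open>Here \<open>2 * sin (pi / 3) = sqrt 3\<close>, and
    \<open>ln (sqrt 3) = ln 3 / 2\<close> produces the logarithmic term.\<close>
  then have "sqrt 3 * gen f'_coeff 3 =
      - 2 * Im (dilog (cis (2 * pi / 3))) - 2 * pi / 3 * ln 3"
    by (simp add: E_def trig_gen_third sin_60 ln_sqrt field_simps)
  then show ?thesis by (simp add: field_simps)
qed

theorem corollary5p4:
  shows "(\<lambda>n. 3 ^ n * f_gam (real (Suc n))) sums (2 * pi / (3 * sqrt 3)) \<and>
         (\<lambda>n. complex_of_real (3 ^ n * (deriv f_gam (real (Suc n)) + ln 3 * f_gam (real (Suc n)))))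
           sums (- L_m3 2) \<and>
         (\<lambda>n. complex_of_real (3 ^ n * deriv f_gam (real (Suc n))))
           sums (- L_m3 2 - complex_of_real (2 * pi / (3 * sqrt 3) * ln 3))"
proof (intro conjI)
  have "sqrt 3 * gen f_coeff 3 = 2 * (pi / 3)"
    using trig_gen_f[of "pi / 3"] by (simp add: trig_gen_third)
  then have "gen f_coeff 3 = 2 * pi / (3 * sqrt 3)" by (simp add: field_simps)
  then show f: "(\<lambda>n. 3 ^ n * f_gam (real (Suc n))) sums (2 * pi / (3 * sqrt 3))"
    using summable_sums[OF summable_f_gam[of 3]] by (simp add: gen_def mult.commute)
  have "(\<lambda>n. f'_coeff n * 3 ^ n) sums gen f'_coeff 3"
    unfolding gen_def by (intro summable_sums summable_deriv_f_gam) simp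
  then have d: "(\<lambda>n. 3 ^ n * f'_coeff n) sums
      (- (2 / sqrt 3 * Im (dilog (cis (2 * pi / 3)))) - 2 * pi / (3 * sqrt 3) * ln 3)"
    by (simp only: gen_f'_3 mult.commute[of "3 ^ _"])
  show "(\<lambda>n. complex_of_real (3 ^ n * f'_coeff n))
      sums (- L_m3 2 - complex_of_real (2 * pi / (3 * sqrt 3) * ln 3))"
    using sums_of_real[OF d, where ?'a = complex] by (simp add: L_m3_2)
  \<comment> \<open>Adding \<open>ln 3\<close> times the first sum cancels the logarithmic
    term.\<close>
  have "(\<lambda>n. 3 ^ n * f'_coeff n + ln 3 * (3 ^ n * f_coeff n)) sums
      (- (2 / sqrt 3 * Im (dilog (cis (2 * pi / 3)))) - 2 * pi / (3 * sqrt 3) * ln 3 +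
        ln 3 * (2 * pi / (3 * sqrt 3)))"
    by (intro sums_add sums_mult d f)
  then have "(\<lambda>n. 3 ^ n * (f'_coeff n + ln 3 * f_coeff n)) sums
      (- (2 / sqrt 3 * Im (dilog (cis (2 * pi / 3)))))"
    by (simp add: algebra_simps)
  from sums_of_real[OF this, where ?'a = complex]
  show "(\<lambda>n. complex_of_real (3 ^ n * (f'_coeff n + ln 3 * f_coeff n))) sums (- L_m3 2)"
    by (simp add: L_m3_2)
qed

end
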